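(* Let $A$ be a Gorenstein algebra over a field $\mathbb{F}$ of characteristic zero with $2<\dim_{\mathbb{F}}A<\infty$, with maximal ideal $\mathfrak{m}$, identity element $\mathbf{1}$, nil-index $\nu$ of $\mathfrak{m}$, and embedding dimension $k=\dim_{\mathbb{F}}\mathfrak{m}/\mathfrak{m}^2$. Let $\Pi$ be a hyperplane in $\mathfrak{m}$ complementary to $\mathrm{Ann}(\mathfrak{m})$, let $\omega:A\to\mathbb{F}$ be a linear form with $\ker\omega=\langle\Pi,\mathbf{1}\rangle$, and let $P=\omega\circ\exp|_{\Pi}$ be the corresponding nil-polynomial on $\Pi$. Let $L\subset\Pi$ be a $k$-dimensional subspace that forms a complement to $\mathfrak{m}^2$ in $\mathfrak{m}$, let $e_1,\dots,e_k$ be a basis of $L$ with corresponding coordinates $y_1,\dots,y_k$, and let $Q\in\mathbb{F}[y_1,\dots,y_k]$ be the restriction of $P$ to $L$ written in these coordinates, i.e. $$Q(y_1,\dots,y_k)=\sum_{j=0}^{\nu}\frac{1}{j!}\,\omega\bigl((y_1e_1+\dots+y_ke_k)^j\bigr).$$ Let $I\subset\mathbb{F}[x_1,\dots,x_k]$ be the ideal of all polynomials $f$ with $f(e_1,\dots,e_k)=0$ in $A$ (so that $A\cong\mathbb{F}[x_1,\dots,x_k]/I$). Then $Q$ is an inverse system for the quotient $\mathbb{F}[x_1,\dots,x_k]/I$.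
   Context: A local commutative associative (unital) $\mathbb{F}$-algebra $A$ of finite vector space dimension greater than $1$ with maximal ideal $\mathfrak{m}$ is called Gorenstein if $\mathrm{Ann}(\mathfrak{m}):=\{u\in\mathfrak{m}: u\,\mathfrak{m}=0\}$ has $\mathbb{F}$-dimension $1$. (In particular $A=\mathbb{F}\mathbf{1}\oplus\mathfrak{m}$.) The nil-index $\nu$ of $\mathfrak{m}$ is the largest integer $\mu$ with $\mathfrak{m}^\mu\ne0$. The exponential map $\exp:\mathfrak{m}\to\mathbf{1}+\mathfrak{m}$ is $\exp(u)=\sum_{m=0}^{\nu}\frac{1}{m!}u^m$ with $u^0:=\mathbf{1}$. The symbol $\langle\,\cdot\,\rangle$ denotes linear span. Since $L$ is a complement to $\mathfrak{m}^2$ in $\mathfrak{m}$, the elements $e_1,\dots,e_k$ generate $A$ as an algebra. For $g\in\mathbb{F}[y_1,\dots,y_k]$ put $$\mathrm{Ann}(g):=\left\{f\in\mathbb{F}[x_1,\dots,x_k]: f\left(\frac{\partial}{\partial y_1},\dots,\frac{\partial}{\partial y_k}\right)(g)=0\right\}.$$ A polynomial $g\in\mathbb{F}[y_1,\dots,y_k]$ of degree $\nu$ is called (Macaulay's) inverse system for the quotient $\mathbb{F}[x_1,\dots,x_k]/I$ if $I=\mathrm{Ann}(g)$. *)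

theory Defs
  imports Complex_Main "HOL-Library.Poly_Mapping" "HOL-Library.Cardinality"
begin

section \<open>Finite-dimensional local algebras\<close>

locale comm_algebra = vector_space scale
  for scale :: "'f::field \<Rightarrow> 'a::comm_ring_1 \<Rightarrow> 'a" +
  assumes scale_mult_left: "scale c x * y = scale c (x * y)"

text \<open>Ideals of a commutative ring are its submodules as a module over itself.\<close>

definition is_ideal :: "'a::comm_ring_1 set \<Rightarrow> bool" where
  "is_ideal J \<longleftrightarrow> module.subspace (*) J"

definition is_maximal_ideal :: "'a::comm_ring_1 set \<Rightarrow> bool" where
  "is_maximal_ideal J \<longleftrightarrow>
     is_ideal J \<and> J \<noteq> UNIV \<and> (\<forall>K. is_ideal K \<and> J \<subseteq> K \<longrightarrow> K = J \<or> K = UNIV)"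

text \<open>\<open>ideal_power J r\<close> is the ideal generated by the \<open>r\<close>-fold products of elements of \<open>J\<close>.\<close>

primrec ideal_power :: "'a::comm_ring_1 set \<Rightarrow> nat \<Rightarrow> 'a set" where
  "ideal_power J 0 = UNIV"
| "ideal_power J (Suc r) = module.span (*) {x * y |x y. x \<in> ideal_power J r \<and> y \<in> J}"

definition nil_index :: "'a::comm_ring_1 set \<Rightarrow> nat" where
  "nil_index J = (GREATEST r. ideal_power J r \<noteq> {0})"

definition Ann_ideal :: "'a::comm_ring_1 set \<Rightarrow> 'a set" where
  "Ann_ideal J = {u \<in> J. \<forall>v\<in>J. u * v = 0}"

locale gorenstein_algebra = comm_algebra scale
  for scale :: "'f::field \<Rightarrow> 'a::comm_ring_1 \<Rightarrow> 'a" +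
  fixes \<mm> :: "'a set"
  assumes finite_dimensional: "\<exists>B. finite B \<and> span B = UNIV"
    and dim_gt_1: "dim UNIV > 1"
    and maximal_ideal: "is_maximal_ideal \<mm>"
    and local: "\<And>J. is_maximal_ideal J \<Longrightarrow> J = \<mm>"
    and dim_Ann: "dim (Ann_ideal \<mm>) = 1"

text \<open>
  \<open>B\<close> is a basis of \<open>V\<close> modulo \<open>W\<close> if the cosets \<open>b + W\<close>, \<open>b \<in> B\<close>, are pairwise distinct and
  form a basis of the quotient space \<open>V/W\<close>. Distinctness is part of the independence condition:
  if \<open>b \<noteq> b'\<close> had the same coset, then \<open>b - b' \<in> W\<close> would be a nontrivial combination.
\<close>

definition basis_modulo ::
  "('f::field \<Rightarrow> 'a::ab_group_add \<Rightarrow> 'a) \<Rightarrow> 'a set \<Rightarrow> 'a set \<Rightarrow> 'a set \<Rightarrow> bool" where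
  "basis_modulo scale V W B \<longleftrightarrow>
     B \<subseteq> V \<and>
     (\<forall>T c. finite T \<and> T \<subseteq> B \<and> (\<Sum>b\<in>T. scale (c b) b) \<in> W \<longrightarrow> (\<forall>b\<in>T. c b = 0)) \<and>
     (\<forall>v\<in>V. \<exists>u\<in>module.span scale B. v - u \<in> W)"

text \<open>\<open>quotient_dim scale V W\<close> is the dimension of \<open>V/W\<close> for subspaces \<open>W \<subseteq> V\<close> with \<open>V/W\<close>
  finite-dimensional.\<close>

definition quotient_dim ::
  "('f::field \<Rightarrow> 'a::ab_group_add \<Rightarrow> 'a) \<Rightarrow> 'a set \<Rightarrow> 'a set \<Rightarrow> nat" where
  "quotient_dim scale V W = card (SOME B. basis_modulo scale V W B)"

definition hyperplane_in ::
  "('f::field \<Rightarrow> 'a::ab_group_add \<Rightarrow> 'a) \<Rightarrow> 'a set \<Rightarrow> 'a set \<Rightarrow> bool" where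
  "hyperplane_in scale V H \<longleftrightarrow>
     module.subspace scale H \<and> H \<subseteq> V \<and> quotient_dim scale V H = 1"

definition complementary_in ::
  "('f::field \<Rightarrow> 'a::ab_group_add \<Rightarrow> 'a) \<Rightarrow> 'a set \<Rightarrow> 'a set \<Rightarrow> 'a set \<Rightarrow> bool" where
  "complementary_in scale V U W \<longleftrightarrow>
     module.subspace scale U \<and> module.subspace scale W \<and>
     U \<inter> W = {0} \<and> {u + w |u w. u \<in> U \<and> w \<in> W} = V"

text \<open>The truncated exponential \<open>exp\<close> on the maximal ideal \<open>\<mm>\<close>; all higher terms vanish on \<open>\<mm>\<close>.\<close>

definition nil_exp :: "('f::field_char_0 \<Rightarrow> 'a::comm_ring_1 \<Rightarrow> 'a) \<Rightarrow> 'a set \<Rightarrow> 'a \<Rightarrow> 'a" where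
  "nil_exp scale \<mm> u = (\<Sum>r\<le>nil_index \<mm>. scale (1 / fact r) (u ^ r))"


section \<open>Polynomials in variables indexed by a finite type\<close>

text \<open>A polynomial maps exponent vectors to coefficients; the product of the ring instance is
  the usual (convolution) product.\<close>

type_synonym ('n, 'f) mpoly = "('n \<Rightarrow>\<^sub>0 nat) \<Rightarrow>\<^sub>0 'f"

text \<open>The value \<open>p(a\<^sub>1,\<dots>,a\<^sub>k)\<close> of a polynomial at elements of an algebra.\<close>

definition mpoly_eval ::
  "('f::field \<Rightarrow> 'a::comm_ring_1 \<Rightarrow> 'a) \<Rightarrow> ('n::finite \<Rightarrow> 'a) \<Rightarrow> ('n, 'f) mpoly \<Rightarrow> 'a" where
  "mpoly_eval scale a p =
     (\<Sum>m\<in>Poly_Mapping.keys p.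
        scale (Poly_Mapping.lookup p m) (\<Prod>i\<in>UNIV. a i ^ Poly_Mapping.lookup m i))"

text \<open>The total degree; the zero polynomial gets degree \<open>0\<close>.\<close>

definition mpoly_degree :: "('n::finite, 'f::zero) mpoly \<Rightarrow> nat" where
  "mpoly_degree p =
     Max (insert 0 ((\<lambda>m. \<Sum>i\<in>UNIV. Poly_Mapping.lookup m i) ` Poly_Mapping.keys p))"

text \<open>The partial derivative \<open>\<partial>/\<partial>y\<^sub>i\<close>. Monomials not containing \<open>y\<^sub>i\<close> contribute \<open>0\<close>, because of
  the factor in front; the truncated subtraction is harmless there.\<close>

definition mpoly_pderiv :: "'n \<Rightarrow> ('n, 'f::field) mpoly \<Rightarrow> ('n, 'f) mpoly" where
  "mpoly_pderiv i g =
     (\<Sum>m\<in>Poly_Mapping.keys g.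
        Poly_Mapping.single (m - Poly_Mapping.single i 1)
          (of_nat (Poly_Mapping.lookup m i) * Poly_Mapping.lookup g m))"

lemma lookup_mpoly_pderiv:
  "Poly_Mapping.lookup (mpoly_pderiv i g) m =
     of_nat (Suc (Poly_Mapping.lookup m i)) * Poly_Mapping.lookup g (m + Poly_Mapping.single i 1)"
proof -
  let ?s = "Poly_Mapping.single i (1::nat)"
  have eq: "(n - ?s = m \<and> Poly_Mapping.lookup n i \<noteq> 0) \<longleftrightarrow> n = m + ?s" for n
    by (auto simp: poly_mapping_eq_iff fun_eq_iff lookup_add lookup_minus lookup_single when_def)
  have "Poly_Mapping.lookup (mpoly_pderiv i g) m =
      (\<Sum>n\<in>Poly_Mapping.keys g. if n = m + ?s then
          of_nat (Suc (Poly_Mapping.lookup m i)) * Poly_Mapping.lookup g (m + ?s) else 0)"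
    unfolding mpoly_pderiv_def lookup_sum
  proof (rule sum.cong[OF refl])
    fix n
    show "Poly_Mapping.lookup (Poly_Mapping.single (n - ?s)
              (of_nat (Poly_Mapping.lookup n i) * Poly_Mapping.lookup g n)) m =
          (if n = m + ?s then
             of_nat (Suc (Poly_Mapping.lookup m i)) * Poly_Mapping.lookup g (m + ?s) else 0)"
      using eq[of n] by (cases "Poly_Mapping.lookup n i = 0") (auto simp: lookup_single when_def lookup_add)
  qed
  also have "\<dots> = of_nat (Suc (Poly_Mapping.lookup m i)) * Poly_Mapping.lookup g (m + ?s)"
    by (simp add: sum.delta in_keys_iff)
  finally show ?thesis .
qed

lemma mpoly_pderiv_commute:
  "mpoly_pderiv i (mpoly_pderiv j g) = mpoly_pderiv j (mpoly_pderiv i g)"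
  by (cases "i = j")
     (auto intro!: poly_mapping_eqI simp: lookup_mpoly_pderiv lookup_add lookup_single when_def
        add_ac mult_ac)

lemma mpoly_pderiv_funpow_commute:
  "(mpoly_pderiv i ^^ a) ((mpoly_pderiv j ^^ b) g) = (mpoly_pderiv j ^^ b) ((mpoly_pderiv i ^^ a) g)"
proof -
  have 1: "mpoly_pderiv i ((mpoly_pderiv j ^^ b) g) = (mpoly_pderiv j ^^ b) (mpoly_pderiv i g)" for g
    by (induction b) (simp_all add: mpoly_pderiv_commute[of i j])
  show ?thesis by (induction a) (simp_all add: 1)
qed

text \<open>The operator \<open>\<Prod>\<^sub>i (\<partial>/\<partial>y\<^sub>i)\<^bsup>m\<^sub>i\<^esup>\<close>. By the following lemma the order in which the finitely
  many commuting factors are composed does not matter, as required for \<open>Finite_Set.fold\<close>.\<close>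

definition monomial_diff :: "('n::finite \<Rightarrow>\<^sub>0 nat) \<Rightarrow> ('n, 'f::field) mpoly \<Rightarrow> ('n, 'f) mpoly" where
  "monomial_diff m g = Finite_Set.fold (\<lambda>i. mpoly_pderiv i ^^ Poly_Mapping.lookup m i) g UNIV"

lemma comp_fun_commute_mpoly_pderiv:
  "comp_fun_commute (\<lambda>i. mpoly_pderiv i ^^ Poly_Mapping.lookup m i)"
  by unfold_locales (auto simp: fun_eq_iff mpoly_pderiv_funpow_commute)

text \<open>\<open>f(\<partial>/\<partial>y\<^sub>1,\<dots>,\<partial>/\<partial>y\<^sub>k)(g)\<close>; multiplication by \<open>single 0 c\<close> is multiplication by the constant \<open>c\<close>.\<close>

definition mpoly_diff :: "('n::finite, 'f::field) mpoly \<Rightarrow> ('n, 'f) mpoly \<Rightarrow> ('n, 'f) mpoly" where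
  "mpoly_diff f g =
     (\<Sum>m\<in>Poly_Mapping.keys f.
        Poly_Mapping.single 0 (Poly_Mapping.lookup f m) * monomial_diff m g)"

definition Ann_poly :: "('n::finite, 'f::field) mpoly \<Rightarrow> ('n, 'f) mpoly set" where
  "Ann_poly g = {f. mpoly_diff f g = 0}"

text \<open>\<open>g\<close> is an inverse system for the quotient of the polynomial ring by \<open>I\<close>. The number \<open>\<nu>\<close> is
  the nil-index of the maximal ideal of that quotient.\<close>

definition inverse_system ::
  "nat \<Rightarrow> ('n::finite, 'f::field) mpoly set \<Rightarrow> ('n, 'f) mpoly \<Rightarrow> bool" where
  "inverse_system \<nu> I g \<longleftrightarrow> mpoly_degree g = \<nu> \<and> I = Ann_poly g"

end

theory Submission
  imports Defs "HOL-Library.FuncSet"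
begin

text \<open>
  Expanding \<open>exp(\<Sum> y\<^sub>i e\<^sub>i) = \<Prod> exp(y\<^sub>i e\<^sub>i)\<close> shows that the coefficient of \<open>Q\<close> at \<open>y\<^sup>m\<close> is
  \<open>\<omega>(e\<^sup>m) / m!\<close>, so the coefficient of \<open>f(\<partial>) Q\<close> at \<open>y\<^sup>m\<close> is \<open>\<omega>(f(e) e\<^sup>m) / m!\<close>. As the monomials \<open>e\<^sup>m\<close>
  span \<open>A\<close>, the equation \<open>f(\<partial>) Q = 0\<close> says that \<open>\<omega>\<close> vanishes on the ideal generated by \<open>f(e)\<close>. A
  nonzero ideal meets the one-dimensional space \<open>Ann(\<mm>)\<close> nontrivially, and \<open>\<omega>\<close> is injective there;
  hence \<open>f(e) = 0\<close>. The degree of \<open>Q\<close> is \<open>\<nu>\<close> because \<open>\<mm>\<^sup>\<nu>\<close> is a nonzero subspace of \<open>Ann(\<mm>)\<close>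
  spanned by monomials of degree \<open>\<nu>\<close>.
\<close>

section \<open>Ideals of a commutative ring and their powers\<close>

lemma module_mult: "module ((*) :: 'a::comm_ring_1 \<Rightarrow> 'a \<Rightarrow> 'a)"
  by unfold_locales (simp_all add: algebra_simps)

lemma is_ideal_iff:
  "is_ideal J \<longleftrightarrow> 0 \<in> J \<and> (\<forall>x\<in>J. \<forall>y\<in>J. x + y \<in> J) \<and> (\<forall>c. \<forall>x\<in>J. c * x \<in> J)"
  by (auto simp: is_ideal_def module.subspace_def[OF module_mult])

lemma is_idealD:
  assumes "is_ideal J"
  shows "0 \<in> J" "x \<in> J \<Longrightarrow> y \<in> J \<Longrightarrow> x + y \<in> J" "x \<in> J \<Longrightarrow> c * x \<in> J" "x \<in> J \<Longrightarrow> x * c \<in> J"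
    "x \<in> J \<Longrightarrow> y \<in> J \<Longrightarrow> x - y \<in> J"
proof -
  note J = assms[unfolded is_ideal_iff]
  have neg: "- x \<in> J" if "x \<in> J" for x
    using J that mult_minus1[of x] by metis
  show "0 \<in> J" "x \<in> J \<Longrightarrow> y \<in> J \<Longrightarrow> x + y \<in> J" "x \<in> J \<Longrightarrow> c * x \<in> J"
    using J by auto
  show "x \<in> J \<Longrightarrow> x * c \<in> J"
    using J by (simp add: mult.commute)
  show "x \<in> J \<Longrightarrow> y \<in> J \<Longrightarrow> x - y \<in> J"
    using J neg diff_conv_add_uminus by metis
qed

text \<open>This set is the ideal \<open>K + (x)\<close>. It serves to enlarge an ideal by one
  element in the maximality arguments.\<close>

lemma is_ideal_coset_sum:
  assumes "is_ideal K"
  shows "is_ideal {k + a * x |k a. k \<in> K}"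
  unfolding is_ideal_iff
proof (intro conjI ballI allI)
  show "0 \<in> {k + a * x |k a. k \<in> K}"
    using is_idealD(1)[OF assms] by (auto intro!: exI[of _ 0])
next
  fix y z assume "y \<in> {k + a * x |k a. k \<in> K}" "z \<in> {k + a * x |k a. k \<in> K}"
  then obtain k a l b where yz: "y = k + a * x" "z = l + b * x" "k \<in> K" "l \<in> K"
    by auto
  then have "y + z = (k + l) + (a + b) * x" "k + l \<in> K"
    using is_idealD(2)[OF assms] by (simp_all add: algebra_simps)
  then show "y + z \<in> {k + a * x |k a. k \<in> K}" by blast
next
  fix c y assume "y \<in> {k + a * x |k a. k \<in> K}"
  then obtain k a where "y = k + a * x" "k \<in> K" by auto
  then have "c * y = c * k + (c * a) * x" "c * k \<in> K"
    by (simp_all add: algebra_simps is_idealD(3)[OF assms])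
  then show "c * y \<in> {k + a * x |k a. k \<in> K}" by blast
qed

lemma is_ideal_ideal_power: "is_ideal (ideal_power J r)"
  by (cases r) (simp_all add: is_ideal_def module.subspace_UNIV[OF module_mult]
      module.subspace_span[OF module_mult])

lemma ideal_power_mult: "x \<in> ideal_power J r \<Longrightarrow> y \<in> J \<Longrightarrow> x * y \<in> ideal_power J (Suc r)"
  by (auto intro!: module.span_base[OF module_mult])

text \<open>Ring coefficients of the span can be absorbed into the left factor, because
  \<open>ideal_power J r\<close> is itself an ideal. The induction step therefore sees plain
  products only.\<close>

lemma ideal_power_Suc_induct [consumes 1, case_names zero step]:
  assumes "x \<in> ideal_power J (Suc r)" "P 0"
    and step: "\<And>a b x. a \<in> ideal_power J r \<Longrightarrow> b \<in> J \<Longrightarrow> P x \<Longrightarrow> P (a * b + x)"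
  shows "P x"
  using assms(1)[unfolded ideal_power.simps]
proof (induction rule: module.span_induct_alt[OF module_mult, consumes 1, case_names base step])
  case (step c x y)
  then obtain a b where "a \<in> ideal_power J r" "b \<in> J" "x = a * b" by auto
  then have "c * a \<in> ideal_power J r" "c * x = (c * a) * b"
    by (auto intro: is_idealD(3) is_ideal_ideal_power)
  with step \<open>b \<in> J\<close> show ?case using assms(3) by metis
qed (fact assms(2))

lemma ideal_power_subset:
  assumes "is_ideal J"
  shows "ideal_power J (Suc r) \<subseteq> J"
proof
  fix x assume "x \<in> ideal_power J (Suc r)"
  then show "x \<in> J"
    by (induction rule: ideal_power_Suc_induct) (auto intro: is_idealD[OF assms])
qed

lemma ideal_power_1:
  assumes "is_ideal J"
  shows "ideal_power J (Suc 0) = J"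
  using ideal_power_subset[OF assms, of 0] ideal_power_mult[of 1 J 0] by auto

lemma ideal_power_Suc_subset: "ideal_power J (Suc r) \<subseteq> ideal_power J r"
proof
  fix x assume "x \<in> ideal_power J (Suc r)"
  then show "x \<in> ideal_power J r"
    by (induction rule: ideal_power_Suc_induct) (auto intro: is_idealD is_ideal_ideal_power)
qed

lemma ideal_power_antimono: "r \<le> s \<Longrightarrow> ideal_power J s \<subseteq> ideal_power J r"
  by (induction s rule: dec_induct) (use ideal_power_Suc_subset in blast)+

text \<open>The extra factor \<open>y\<close> allows products of several powers to be built up one
  factor at a time.\<close>

lemma power_in_ideal_power:
  assumes "is_ideal J" "x \<in> J"
  shows "y \<in> ideal_power J s \<Longrightarrow> y * x ^ r \<in> ideal_power J (s + r)"
proof (induction r)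
  case (Suc r)
  have "y * x ^ r * x \<in> ideal_power J (Suc (s + r))"
    by (rule ideal_power_mult) (use Suc assms in auto)
  then show ?case by (simp add: mult_ac)
qed simp

section \<open>Ideals and products of spans in an algebra over a field\<close>

context comm_algebra
begin

lemma scale_mult_right: "x * scale c y = scale c (x * y)"
  by (metis mult.commute scale_mult_left)

lemma scale_power: "scale c x ^ r = scale (c ^ r) (x ^ r)"
  by (induction r) (simp_all add: scale_mult_left scale_mult_right)

lemma prod_scale: "finite S \<Longrightarrow> (\<Prod>i\<in>S. scale (c i) (x i)) = scale (\<Prod>i\<in>S. c i) (\<Prod>i\<in>S. x i)"
  by (induction S rule: finite_induct) (simp_all add: scale_mult_left scale_mult_right)

text \<open>Scaling by \<open>c\<close> is ring multiplication by \<open>scale c 1\<close>.\<close>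

lemma is_ideal_subspace:
  assumes "is_ideal J"
  shows "subspace J"
proof (rule subspaceI)
  fix c x assume "x \<in> J"
  then have "scale c 1 * x \<in> J" by (rule is_idealD[OF assms])
  then show "scale c x \<in> J" by (simp add: scale_mult_left)
qed (use assms in \<open>auto simp: is_ideal_iff\<close>)

lemma span_mult:
  assumes "x \<in> span X" "y \<in> span Y" and XY: "\<And>x y. x \<in> X \<Longrightarrow> y \<in> Y \<Longrightarrow> x * y \<in> span Z"
  shows "x * y \<in> span Z"
  using assms(1)
proof (induction rule: span_induct_alt)
  case (step c x x')
  have "x * y \<in> span Z"
    using assms(2)
  proof (induction rule: span_induct_alt)
    case (step d y y')
    then show ?case using XY[OF \<open>x \<in> X\<close> \<open>y \<in> Y\<close>]
      by (simp add: distrib_left scale_mult_right span_add span_scale)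
  qed (simp add: span_zero)
  with step show ?case
    by (simp add: distrib_right scale_mult_left span_add span_scale)
qed (simp add: span_zero)

end

section \<open>Nilpotency of the maximal ideal, its annihilator and the residue field\<close>

context gorenstein_algebra
begin

text \<open>Thinning a finite spanning set to a basis makes the library results on dimension
  available.\<close>

lemma obtain_Basis:
  obtains B where "finite_dimensional_vector_space scale B"
proof -
  obtain C where C: "finite C" "span C = UNIV" using finite_dimensional by blast
  obtain B where B: "B \<subseteq> C" "independent B" "C \<subseteq> span B"
    using maximal_independent_subset[of C] by blast
  have "span B = UNIV"
    using C(2) span_minimal[OF B(3) subspace_span] by auto
  with B C(1) have "finite_dimensional_vector_space scale B"
    by unfold_locales (auto intro: finite_subset)
  then show ?thesis by (rule that)
qed

lemma subspace_dim_eq: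
  assumes "subspace S" "subspace T" "S \<subseteq> T" "dim T \<le> dim S"
  shows "S = T"
proof -
  obtain B where "finite_dimensional_vector_space scale B" by (rule obtain_Basis)
  from finite_dimensional_vector_space.subspace_dim_equal[OF this] show ?thesis using assms by blast
qed

lemma dim_mono_subset:
  assumes "S \<subseteq> T"
  shows "dim S \<le> dim T"
proof -
  obtain B where "finite_dimensional_vector_space scale B" by (rule obtain_Basis)
  from finite_dimensional_vector_space.dim_subset[OF this] show ?thesis using assms by blast
qed

lemma dim_zero: "dim {0} = 0"
  by (metis dim_span dim_eq_card independent_empty span_empty card.empty)

lemma dim_single: "x \<noteq> 0 \<Longrightarrow> dim {x} = 1"
  using dim_eq_card_independent[of "{x}"] by simp

text \<open>Dimensions are bounded by \<open>dim UNIV\<close>, so this takes the place of Zorn's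
  lemma below.\<close>

lemma obtain_maximal_dim:
  assumes "P K"
  obtains J where "P J" "\<And>J'. P J' \<Longrightarrow> dim J' \<le> dim J"
  using Nat.ex_has_greatest_nat[of "\<lambda>d. \<exists>J. P J \<and> dim J = d" "dim K" "dim UNIV"] assms
    dim_mono_subset[OF subset_UNIV] by blast

lemma one_neq_zero: "(1::'a) \<noteq> 0"
proof
  assume "(1::'a) = 0"
  then have "x = 0" for x :: 'a using mult_1[of x] by simp
  then have "(UNIV :: 'a set) = {0}" by auto
  then show False using dim_gt_1 dim_zero by simp
qed

lemma ideal_\<mm>: "is_ideal \<mm>" and one_notin_\<mm>: "1 \<notin> \<mm>"
proof -
  show *: "is_ideal \<mm>" using maximal_ideal by (simp add: is_maximal_ideal_def)
  show "1 \<notin> \<mm>"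
  proof
    assume "1 \<in> \<mm>"
    then have "x \<in> \<mm>" for x using is_idealD(3)[OF *, of 1 x] by simp
    then show False using maximal_ideal by (auto simp: is_maximal_ideal_def)
  qed
qed

text \<open>If \<open>x\<close> had no inverse, an ideal of greatest dimension among those
  containing \<open>x\<close> but not \<open>1\<close> would be a maximal ideal, hence equal to
  \<open>\<mm>\<close> by locality.\<close>

lemma unit_if_notin_\<mm>:
  assumes "x \<notin> \<mm>"
  shows "\<exists>y. y * x = 1"
proof (rule ccontr)
  assume no_inv: "\<nexists>y. y * x = 1"
  define P where "P J \<longleftrightarrow> is_ideal J \<and> x \<in> J \<and> 1 \<notin> J" for J
  have "is_ideal {k + a * x |k a. k \<in> {0}}"
    by (rule is_ideal_coset_sum) (simp add: is_ideal_iff)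
  moreover have "x \<in> {k + a * x |k a. k \<in> {0}}" by (auto intro!: exI[of _ 1])
  ultimately have "P {k + a * x |k a. k \<in> {0}}" using no_inv by (auto simp: P_def)
  then obtain J where J: "P J" "\<And>J'. P J' \<Longrightarrow> dim J' \<le> dim J" by (rule obtain_maximal_dim) blast
  have "is_maximal_ideal J"
    unfolding is_maximal_ideal_def
  proof (intro conjI allI impI)
    fix K assume K: "is_ideal K \<and> J \<subseteq> K"
    show "K = J \<or> K = UNIV"
    proof (cases "1 \<in> K")
      case True
      then have "y \<in> K" for y using K is_idealD(3)[of K 1 y] by simp
      then show ?thesis by auto
    next
      case False
      with K J have "dim K \<le> dim J" by (auto simp: P_def)
      with K J subspace_dim_eq[of J K] show ?thesis by (auto simp: P_def is_ideal_subspace)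
    qed
  qed (use J in \<open>auto simp: P_def\<close>)
  with local J assms show False by (auto simp: P_def)
qed

text \<open>A maximal proper subideal \<open>K\<close> of \<open>N\<close> contains \<open>\<mm> N\<close>, as \<open>1 - a\<close> is a unit for \<open>a \<in> \<mm>\<close>.\<close>

lemma ideal_power_strict_decreasing:
  assumes "ideal_power \<mm> r \<noteq> {0}"
  shows "ideal_power \<mm> (Suc r) \<noteq> ideal_power \<mm> r"
proof
  assume eq: "ideal_power \<mm> (Suc r) = ideal_power \<mm> r"
  define N where "N = ideal_power \<mm> r"
  have N: "is_ideal N" unfolding N_def by (rule is_ideal_ideal_power)
  define P where "P K \<longleftrightarrow> is_ideal K \<and> K \<subset> N" for K
  have "P {0}"
    using assms is_idealD(1)[OF N] by (auto simp: P_def is_ideal_iff N_def)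
  then obtain K where K: "P K" "\<And>K'. P K' \<Longrightarrow> dim K' \<le> dim K" by (rule obtain_maximal_dim) blast
  then have K_ideal: "is_ideal K" and "K \<subset> N" by (auto simp: P_def)
  then obtain x where x: "x \<in> N" "x \<notin> K" by blast
  define K' where "K' = {k + a * x |k a. k \<in> K}"
  have K': "is_ideal K'" unfolding K'_def by (rule is_ideal_coset_sum[OF K_ideal])
  have "k = k + 0 * x" for k by simp
  then have "K \<subseteq> K'" unfolding K'_def by blast
  have "x = 0 + 1 * x" by simp
  then have "x \<in> K'" unfolding K'_def using is_idealD(1)[OF K_ideal] by blast
  have "K' \<subseteq> N" using \<open>K \<subset> N\<close> x(1) is_idealD[OF N] by (auto simp: K'_def)
  have "K' = N"
  proof (rule ccontr)
    assume "K' \<noteq> N"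
    then have "dim K' \<le> dim K" using K' \<open>K' \<subseteq> N\<close> by (intro K(2)) (auto simp: P_def)
    with \<open>K \<subseteq> K'\<close> K' K_ideal have "K = K'" by (intro subspace_dim_eq is_ideal_subspace)
    with x \<open>x \<in> K'\<close> show False by simp
  qed
  \<comment> \<open>Since \<open>N = K + (x)\<close>, multiplying elements of \<open>N\<close> by
    elements of \<open>\<mm>\<close> yields coefficients of \<open>x\<close> that lie in
    \<open>\<mm>\<close>. Applied to \<open>x\<close> itself, an element of
    \<open>\<mm> N = N\<close>, this puts \<open>(1 - a) * x\<close> into \<open>K\<close>.\<close>
  have "\<exists>k\<in>K. \<exists>a\<in>\<mm>. y = k + a * x" if "y \<in> ideal_power \<mm> (Suc r)" for y
    using that
  proof (induction rule: ideal_power_Suc_induct)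
    case zero
    show ?case using is_idealD(1)[OF K_ideal] is_idealD(1)[OF ideal_\<mm>] by (auto intro!: bexI[of _ 0])
  next
    case (step b c z)
    then obtain k a where 1: "k \<in> K" "a \<in> \<mm>" "z = k + a * x" by blast
    from step(1) have "b \<in> K'" using \<open>K' = N\<close> by (simp add: N_def)
    then obtain l d where 2: "l \<in> K" "b = l + d * x" by (auto simp: K'_def)
    have "b * c + z = (l * c + k) + (d * c + a) * x"
      by (simp add: 1 2 algebra_simps)
    moreover have "l * c + k \<in> K" "d * c + a \<in> \<mm>"
      using 1 2 step(2) is_idealD[OF K_ideal] is_idealD[OF ideal_\<mm>] by auto
    ultimately show ?case by blast
  qed
  then obtain k a where ka: "k \<in> K" "a \<in> \<mm>" "x = k + a * x"
    using x(1) eq N_def by blast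
  have "1 - a \<notin> \<mm>"
    using is_idealD(2)[OF ideal_\<mm>, of "1 - a" a] ka(2) one_notin_\<mm> by auto
  then obtain b where b: "b * (1 - a) = 1" using unit_if_notin_\<mm> by blast
  have "(1 - a) * x = k" using ka(3) by (simp add: algebra_simps)
  then have "x = b * k" using b by (metis mult.assoc mult_1)
  then show False using ka(1) x(2) is_idealD(3)[OF K_ideal] by simp
qed

text \<open>As long as the powers are nonzero, each one has smaller dimension than its
  predecessor.\<close>

lemma ideal_power_eventually_zero: "\<exists>r. ideal_power \<mm> r = {0}"
proof (rule ccontr)
  assume *: "\<nexists>r. ideal_power \<mm> r = {0}"
  have "dim (ideal_power \<mm> r) + r \<le> dim UNIV" for r
  proof (induction r)
    case (Suc r)
    have "\<not> dim (ideal_power \<mm> r) \<le> dim (ideal_power \<mm> (Suc r))"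
      using subspace_dim_eq[of "ideal_power \<mm> (Suc r)" "ideal_power \<mm> r"]
        ideal_power_Suc_subset ideal_power_strict_decreasing *
      by (meson is_ideal_ideal_power is_ideal_subspace)
    with Suc show ?case by linarith
  qed simp
  from this[of "Suc (dim UNIV)"] show False by simp
qed

text \<open>The \<open>GREATEST\<close> in \<open>nil_index\<close> is meaningful: exponent
  \<open>0\<close> qualifies, and qualifying exponents are bounded because some power vanishes and
  the powers decrease.\<close>

lemma nil_index_props:
  shows ideal_power_nil_index: "ideal_power \<mm> (nil_index \<mm>) \<noteq> {0}"
    and ideal_power_gt_nil_index: "\<And>r. r > nil_index \<mm> \<Longrightarrow> ideal_power \<mm> r = {0}"
proof -
  obtain s where s: "ideal_power \<mm> s = {0}" using ideal_power_eventually_zero by blast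
  have bound: "r \<le> s" if "ideal_power \<mm> r \<noteq> {0}" for r
  proof (rule ccontr)
    assume "\<not> r \<le> s"
    then have "ideal_power \<mm> r \<subseteq> {0}" using ideal_power_antimono[of s r \<mm>] s by simp
    with that is_idealD(1)[OF is_ideal_ideal_power] show False by blast
  qed
  have 0: "ideal_power \<mm> 0 \<noteq> {0}"
    using one_neq_zero UNIV_I[of "1::'a"] by (metis ideal_power.simps(1) singletonD)
  show "ideal_power \<mm> (nil_index \<mm>) \<noteq> {0}"
    unfolding nil_index_def using GreatestI_nat[of "\<lambda>r. ideal_power \<mm> r \<noteq> {0}", OF 0] bound by blast
  show "ideal_power \<mm> r = {0}" if "r > nil_index \<mm>" for r
    using Greatest_le_nat[of "\<lambda>r. ideal_power \<mm> r \<noteq> {0}" r s] bound that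
    unfolding nil_index_def by fastforce
qed

lemma subspace_Ann: "subspace (Ann_ideal \<mm>)"
  by (intro is_ideal_subspace)
    (auto simp: is_ideal_iff Ann_ideal_def distrib_right mult.assoc intro: is_idealD[OF ideal_\<mm>])

lemma \<mm>_neq_zero: "\<mm> \<noteq> {0}"
proof
  assume "\<mm> = {0}"
  then have "Ann_ideal \<mm> = {0}" by (auto simp: Ann_ideal_def)
  with dim_Ann dim_zero show False by simp
qed

lemma nil_index_pos: "nil_index \<mm> > 0"
  using ideal_power_gt_nil_index[of "Suc 0"] ideal_power_1[OF ideal_\<mm>] \<mm>_neq_zero by auto

lemma Ann_multiple:
  assumes "u \<in> Ann_ideal \<mm>" "u \<noteq> 0" "v \<in> Ann_ideal \<mm>"
  shows "\<exists>c. v = scale c u"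
proof -
  have "span {u} = Ann_ideal \<mm>"
    using assms dim_Ann dim_single by (intro subspace_dim_eq subspace_span subspace_Ann span_minimal) auto
  with assms(3) show ?thesis by (auto simp: span_singleton)
qed

text \<open>The residue field is the ground field: \<open>x\<close> acts on the one-dimensional
  annihilator by some scalar \<open>c\<close>, so \<open>x - scale c 1\<close> kills a nonzero
  element and cannot be a unit.\<close>

lemma obtain_scalar_modulo_\<mm>:
  obtains c where "x - scale c 1 \<in> \<mm>"
proof -
  obtain u where u: "u \<in> Ann_ideal \<mm>" "u \<noteq> 0"
  proof (rule ccontr)
    assume "\<not> thesis"
    with that have "Ann_ideal \<mm> = {0}" using subspace_0[OF subspace_Ann] by blast
    with dim_Ann dim_zero show False by simp
  qed
  have "x * u \<in> Ann_ideal \<mm>"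
    using u is_idealD(3)[OF ideal_\<mm>] by (auto simp: Ann_ideal_def mult.assoc)
  then obtain c where c: "x * u = scale c u" using Ann_multiple u by blast
  have "(x - scale c 1) * u = 0" using c by (simp add: left_diff_distrib scale_mult_left)
  then have "x - scale c 1 \<in> \<mm>"
    using unit_if_notin_\<mm>[of "x - scale c 1"] u(2) by (metis mult.assoc mult_1 mult_zero_right)
  then show ?thesis by (rule that)
qed

text \<open>Choose \<open>r\<close> such that \<open>a\<close> kills the power \<open>Suc r\<close>
  of \<open>\<mm>\<close> but not the power \<open>r\<close>. A nonzero product \<open>a * x\<close>
  with \<open>x\<close> in the latter is then killed by \<open>\<mm>\<close>.\<close>

lemma obtain_multiple_in_Ann:
  assumes "a \<noteq> 0"
  obtains x where "a * x \<in> Ann_ideal \<mm>" "a * x \<noteq> 0"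
proof -
  define P where "P r \<longleftrightarrow> (\<forall>x\<in>ideal_power \<mm> r. a * x = 0)" for r
  have "P (Suc (nil_index \<mm>))"
    using ideal_power_gt_nil_index[of "Suc (nil_index \<mm>)"] by (simp add: P_def del: ideal_power.simps)
  moreover have "\<not> P 0" using assms by (auto simp: P_def intro!: exI[of _ 1])
  ultimately obtain r where "\<not> P r" "P (Suc r)"
    using nat_induct[of "\<lambda>r. \<not> P r"] by blast
  then obtain x where x: "x \<in> ideal_power \<mm> r" "a * x \<noteq> 0" by (auto simp: P_def)
  have ann: "a * x * y = 0" if "y \<in> \<mm>" for y
    using ideal_power_mult[OF x(1) that] \<open>P (Suc r)\<close> by (auto simp: P_def mult.assoc)
  \<comment> \<open>A unit that kills \<open>\<mm>\<close> would force
    \<open>\<mm> = {0}\<close>.\<close>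
  have "a * x \<in> \<mm>"
  proof (rule ccontr)
    assume "a * x \<notin> \<mm>"
    then obtain b where b: "b * (a * x) = 1" using unit_if_notin_\<mm> by blast
    have "y = 0" if "y \<in> \<mm>" for y
      using ann[OF that] b by (metis mult.assoc mult_1 mult_zero_right)
    with is_idealD(1)[OF ideal_\<mm>] \<mm>_neq_zero show False by blast
  qed
  with ann x(2) show ?thesis by (intro that[of x]) (auto simp: Ann_ideal_def)
qed

end

section \<open>Monomials: values, degrees, factorials and independence as functions\<close>

definition monomial_value :: "('n::finite \<Rightarrow> 'a::comm_ring_1) \<Rightarrow> ('n \<Rightarrow>\<^sub>0 nat) \<Rightarrow> 'a" where
  "monomial_value a m = (\<Prod>i\<in>UNIV. a i ^ Poly_Mapping.lookup m i)"

definition monomial_degree :: "('n::finite \<Rightarrow>\<^sub>0 nat) \<Rightarrow> nat" where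
  "monomial_degree m = (\<Sum>i\<in>UNIV. Poly_Mapping.lookup m i)"

definition monomial_fact :: "('n::finite \<Rightarrow>\<^sub>0 nat) \<Rightarrow> 'f::field_char_0" where
  "monomial_fact m = (\<Prod>i\<in>UNIV. fact (Poly_Mapping.lookup m i))"

lemma monomial_value_0 [simp]: "monomial_value a 0 = 1"
  by (simp add: monomial_value_def)

lemma monomial_degree_0 [simp]: "monomial_degree 0 = 0"
  by (simp add: monomial_degree_def)

lemma monomial_fact_neq_0 [simp]: "monomial_fact m \<noteq> 0"
  by (simp add: monomial_fact_def)

lemma monomial_value_add: "monomial_value a (m + n) = monomial_value a m * monomial_value a n"
  by (simp add: monomial_value_def lookup_add power_add prod.distrib)

lemma monomial_degree_add: "monomial_degree (m + n) = monomial_degree m + monomial_degree n"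
  by (simp add: monomial_degree_def lookup_add sum.distrib)

lemma prod_UNIV_single:
  fixes g :: "'n::finite \<Rightarrow> nat \<Rightarrow> 'b::comm_monoid_mult"
  assumes "\<And>j. g j 0 = 1"
  shows "(\<Prod>j\<in>UNIV. g j (Poly_Mapping.lookup (Poly_Mapping.single i c) j)) = g i c"
proof -
  have "(\<Prod>j\<in>UNIV. g j (Poly_Mapping.lookup (Poly_Mapping.single i c) j)) =
      (\<Prod>j\<in>UNIV. if j = i then g j c else 1)"
    by (rule prod.cong) (auto simp: lookup_single when_def assms)
  then show ?thesis by simp
qed

lemma monomial_value_single: "monomial_value a (Poly_Mapping.single i c) = a i ^ c"
  unfolding monomial_value_def by (rule prod_UNIV_single) simp

lemma monomial_degree_single: "monomial_degree (Poly_Mapping.single i c) = c"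
proof -
  have "monomial_degree (Poly_Mapping.single i c) = (\<Sum>j\<in>UNIV. if j = i then c else 0)"
    unfolding monomial_degree_def by (rule sum.cong) (auto simp: lookup_single when_def)
  then show ?thesis by simp
qed

lemma monomial_fact_add_single:
  "monomial_fact (m + Poly_Mapping.single i 1) =
    of_nat (Suc (Poly_Mapping.lookup m i)) * monomial_fact m"
proof -
  have "monomial_fact (m + Poly_Mapping.single i 1) =
    (\<Prod>j\<in>UNIV. (if j = i then of_nat (Suc (Poly_Mapping.lookup m i)) else 1) *
      fact (Poly_Mapping.lookup m j))"
    unfolding monomial_fact_def by (rule prod.cong) (auto simp: lookup_add lookup_single when_def)
  then show ?thesis by (simp add: prod.distrib monomial_fact_def)
qed

lemma mpoly_eval_conv_monomial_value:
  "mpoly_eval scale a p =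
    (\<Sum>m\<in>Poly_Mapping.keys p. scale (Poly_Mapping.lookup p m) (monomial_value a m))"
  by (simp add: mpoly_eval_def monomial_value_def)

lemma mpoly_degree_conv_monomial_degree:
  "mpoly_degree p = Max (insert 0 (monomial_degree ` Poly_Mapping.keys p))"
  by (simp add: mpoly_degree_def monomial_degree_def)

text \<open>Dedekind's argument: distinct monomials are distinct multiplicative functions.\<close>

lemma monomial_functions_independent:
  fixes c :: "('n::finite \<Rightarrow>\<^sub>0 nat) \<Rightarrow> 'f::field_char_0"
  assumes "finite M" "\<And>y. (\<Sum>m\<in>M. c m * monomial_value y m) = 0" "m \<in> M"
  shows "c m = 0"
  using assms
proof (induction M arbitrary: c m rule: finite_induct)
  case (insert m0 M)
  have 0: "c m = 0" if "m \<in> M" for m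
  proof -
    from that insert.hyps have "m \<noteq> m0" by auto
    then obtain i where i: "Poly_Mapping.lookup m i \<noteq> Poly_Mapping.lookup m0 i"
      by (metis poly_mapping_eqI)
    \<comment> \<open>Passing from \<open>y\<close> to \<open>y * z\<close> multiplies each monomial
      by a power of \<open>2\<close>, with different powers for \<open>m\<close> and
      \<open>m0\<close> in characteristic zero. Subtracting a multiple of the original relation
      removes \<open>m0\<close>.\<close>
    define z :: "'n \<Rightarrow> 'f" where "z j = (if j = i then 2 else 1)" for j
    have z: "monomial_value z n = 2 ^ Poly_Mapping.lookup n i" for n :: "'n \<Rightarrow>\<^sub>0 nat"
    proof -
      have "monomial_value z n = (\<Prod>j\<in>UNIV. if j = i then 2 ^ Poly_Mapping.lookup n j else 1)"
        unfolding monomial_value_def z_def by (rule prod.cong) auto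
      then show ?thesis by simp
    qed
    have "c m * (monomial_value z m - monomial_value z m0) = 0"
    proof (rule insert.IH[OF _ that])
      fix y
      have "monomial_value (\<lambda>j. y j * z j) n = monomial_value y n * monomial_value z n" for n
        by (simp add: monomial_value_def power_mult_distrib prod.distrib)
      with insert.prems(1)[of "\<lambda>j. y j * z j"] insert.hyps
      have 1: "c m0 * monomial_value y m0 * monomial_value z m0 +
          (\<Sum>m\<in>M. c m * monomial_value y m * monomial_value z m) = 0"
        by (simp add: mult_ac)
      have "c m0 * monomial_value y m0 + (\<Sum>m\<in>M. c m * monomial_value y m) = 0"
        using insert.prems(1)[of y] insert.hyps by simp
      then have 2: "c m0 * monomial_value y m0 * monomial_value z m0 +
          (\<Sum>m\<in>M. c m * monomial_value y m * monomial_value z m0) = 0"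
        by (metis distrib_right mult_zero_left sum_distrib_right)
      have "(\<Sum>m\<in>M. c m * (monomial_value z m - monomial_value z m0) * monomial_value y m) =
          (\<Sum>m\<in>M. c m * monomial_value y m * monomial_value z m) -
          (\<Sum>m\<in>M. c m * monomial_value y m * monomial_value z m0)"
        by (simp add: sum_subtractf[symmetric] algebra_simps)
      also have "\<dots> = 0" using 1 2 by (simp add: add_eq_0_iff)
      finally show "(\<Sum>m\<in>M. c m * (monomial_value z m - monomial_value z m0) * monomial_value y m) = 0" .
    qed
    moreover have "(2 :: 'f) ^ Poly_Mapping.lookup m i \<noteq> 2 ^ Poly_Mapping.lookup m0 i"
    proof
      assume "(2 :: 'f) ^ Poly_Mapping.lookup m i = 2 ^ Poly_Mapping.lookup m0 i"
      then have "of_nat (2 ^ Poly_Mapping.lookup m i) = (of_nat (2 ^ Poly_Mapping.lookup m0 i) :: 'f)"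
        by simp
      with i show False by (simp only: of_nat_eq_iff power_inject_exp)
    qed
    ultimately show ?thesis by (simp add: z)
  qed
  have "c m0 = 0"
    using insert.prems(1)[of "\<lambda>_. 1"] insert.hyps 0 by (simp add: monomial_value_def)
  with 0 insert.prems(2) show ?case by auto
qed simp

lemma lookup_single_0_mult:
  fixes c :: "'f::comm_ring_1"
  shows "Poly_Mapping.lookup (Poly_Mapping.single 0 c * p) m = c * Poly_Mapping.lookup p m"
  by (simp add: mult_map_scale_conv_mult[symmetric] Poly_Mapping.map.rep_eq when_def)

section \<open>Spans of monomials of bounded below degree in an algebra\<close>

context comm_algebra
begin

text \<open>A span over the field, whereas \<open>ideal_power\<close> uses spans over the ring. If
  the \<open>a i\<close> lie in \<open>\<mm>\<close> and span it modulo its square, the two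
  filtrations are shown to agree.\<close>

abbreviation monomial_span :: "('n::finite \<Rightarrow> 'a) \<Rightarrow> nat \<Rightarrow> 'a set" where
  "monomial_span a r \<equiv> span (monomial_value a ` {m. r \<le> monomial_degree m})"

lemma monomial_span_mult:
  assumes "x \<in> monomial_span a r" "y \<in> monomial_span a s"
  shows "x * y \<in> monomial_span a (r + s)"
  using assms
  by (rule span_mult) (auto simp: monomial_value_add[symmetric] monomial_degree_add intro!: span_base)

lemma monomial_span_antimono: "r \<le> s \<Longrightarrow> monomial_span a s \<subseteq> monomial_span a r"
  by (intro span_mono) auto

lemma generator_in_monomial_span: "a i \<in> monomial_span a 1"
  using monomial_value_single[of a i 1] monomial_degree_single[of i 1]
  by (intro span_base image_eqI[of _ _ "Poly_Mapping.single i 1"]) auto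

lemma one_in_monomial_span: "1 \<in> monomial_span a 0"
  by (intro span_base image_eqI[of _ _ 0]) auto

end

lemma monomial_value_in_ideal_power:
  assumes "is_ideal J" "\<And>i. a i \<in> J"
  shows "monomial_value a m \<in> ideal_power J (monomial_degree m)"
proof -
  have "(\<Prod>i\<in>S. a i ^ Poly_Mapping.lookup m i) \<in> ideal_power J (\<Sum>i\<in>S. Poly_Mapping.lookup m i)"
    if "finite S" for S
    using that
  proof (induction S rule: finite_induct)
    case (insert i S)
    then show ?case using power_in_ideal_power[OF assms(1) assms(2) insert.IH]
      by (simp add: mult.commute add.commute)
  qed simp
  then show ?thesis by (simp add: monomial_value_def monomial_degree_def)
qed

section \<open>Powers of the maximal ideal are spanned by monomials in the generators\<close>

context gorenstein_algebra
begin

context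
  fixes e :: "'n::finite \<Rightarrow> 'a"
  assumes gen: "\<And>x. x \<in> \<mm> \<Longrightarrow> \<exists>u\<in>span (range e). x - u \<in> ideal_power \<mm> 2"
    and gen_in_\<mm>: "range e \<subseteq> \<mm>"
begin

lemma monomial_value_in_power: "monomial_value e m \<in> ideal_power \<mm> (monomial_degree m)"
  using monomial_value_in_ideal_power[OF ideal_\<mm>] gen_in_\<mm> by blast

lemma monomial_span_subset_power: "monomial_span e r \<subseteq> ideal_power \<mm> r"
  using monomial_value_in_power ideal_power_antimono
  by (intro span_minimal is_ideal_subspace is_ideal_ideal_power) blast

text \<open>Successive approximation: each element of \<open>\<mm>\<close> is a combination of
  monomials up to an error in \<open>ideal_power \<mm> (Suc r)\<close>, and the error vanishes for
  \<open>r = nil_index \<mm>\<close>.\<close>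

lemma \<mm>_eq_monomial_span: "\<mm> = monomial_span e 1"
proof
  show sub: "monomial_span e 1 \<subseteq> \<mm>"
    using monomial_span_subset_power[of 1] ideal_power_1[OF ideal_\<mm>] by simp
  have approx: "\<exists>s\<in>monomial_span e 1. x - s \<in> ideal_power \<mm> (Suc r)" if "x \<in> \<mm>" for x r
    using that
  proof (induction r arbitrary: x)
    case 0
    then show ?case using ideal_power_1[OF ideal_\<mm>] by (intro bexI[of _ 0]) (auto intro: span_zero)
  next
    case (Suc r)
    let ?K = "ideal_power \<mm> (Suc (Suc r))"
    \<comment> \<open>By \<open>gen\<close>, elements of \<open>\<mm>\<close> are linear in the
      \<open>e i\<close> up to the square of \<open>\<mm>\<close>, so only elements \<open>w\<close>
      of the square remain to be approximated one order better.\<close>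
    have "\<exists>s\<in>monomial_span e 1. w - s \<in> ?K" if "w \<in> ideal_power \<mm> (Suc (Suc 0))" for w
      using that
    proof (induction rule: ideal_power_Suc_induct)
      case zero
      show ?case using is_idealD(1)[OF is_ideal_ideal_power] span_zero
        by (intro bexI[of _ 0]) (simp_all del: ideal_power.simps)
    next
      case (step x y w)
      then have x: "x \<in> \<mm>" using ideal_power_1[OF ideal_\<mm>] by blast
      from Suc.IH[OF x] obtain s where s: "s \<in> monomial_span e 1" "x - s \<in> ideal_power \<mm> (Suc r)" by blast
      from Suc.IH[OF step(2)] obtain t where t: "t \<in> monomial_span e 1" "y - t \<in> ideal_power \<mm> (Suc r)" by blast
      from step obtain q where q: "q \<in> monomial_span e 1" "w - q \<in> ?K" by blast
      have "s * t \<in> monomial_span e 1"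
        using monomial_span_mult[OF s(1) t(1)] monomial_span_antimono[of 1 "1 + 1" e] by auto
      then have "s * t + q \<in> monomial_span e 1" using q by (blast intro: span_add)
      \<comment> \<open>The error of \<open>s * t\<close> as an approximation of
        \<open>x * y\<close> is the sum of these two terms; the additional factor from
        \<open>\<mm>\<close> in each gains one order.\<close>
      moreover have "(x - s) * y \<in> ?K" "(y - t) * s \<in> ?K"
        using ideal_power_mult s t step(2) sub by blast+
      then have "(x - s) * y + (y - t) * s + (w - q) \<in> ?K"
        using q by (intro is_idealD(2)[OF is_ideal_ideal_power])
      then have "x * y + w - (s * t + q) \<in> ?K" by (simp add: algebra_simps del: ideal_power.simps)
      ultimately show ?case by blast
    qed
    moreover obtain u where u: "u \<in> span (range e)" "x - u \<in> ideal_power \<mm> 2"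
      using gen Suc.prems by blast
    ultimately obtain s where s: "s \<in> monomial_span e 1" "x - u - s \<in> ?K"
      by (metis numeral_2_eq_2)
    have "u \<in> monomial_span e 1"
      using u(1) span_minimal[of "range e", OF _ subspace_span] generator_in_monomial_span by blast
    then have "u + s \<in> monomial_span e 1" using s by (blast intro: span_add)
    with s(2) show ?case by (metis diff_diff_eq)
  qed
  show "\<mm> \<subseteq> monomial_span e 1"
  proof
    fix x assume "x \<in> \<mm>"
    from approx[OF this, of "nil_index \<mm>"] ideal_power_gt_nil_index[of "Suc (nil_index \<mm>)"]
    obtain s where "s \<in> monomial_span e 1" "x - s = 0" by (auto simp del: ideal_power.simps)
    then show "x \<in> monomial_span e 1" by simp
  qed
qed

lemma monomial_span_0: "monomial_span e 0 = UNIV"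
proof -
  have "x \<in> monomial_span e 0" for x
  proof -
    obtain c where "x - scale c 1 \<in> \<mm>" by (rule obtain_scalar_modulo_\<mm>)
    then have "x - scale c 1 \<in> monomial_span e 0"
      using \<mm>_eq_monomial_span monomial_span_antimono[of 0 1 e] by auto
    from span_add[OF this span_scale[OF one_in_monomial_span, of c]] show ?thesis by simp
  qed
  then show ?thesis by blast
qed

lemma ideal_power_subset_monomial_span: "ideal_power \<mm> r \<subseteq> monomial_span e r"
proof (induction r)
  case 0
  show ?case using monomial_span_0 by simp
next
  case (Suc r)
  show ?case
  proof
    fix x assume "x \<in> ideal_power \<mm> (Suc r)"
    then show "x \<in> monomial_span e (Suc r)"
    proof (induction rule: ideal_power_Suc_induct)
      case (step a b x)
      then have "a * b \<in> monomial_span e (r + 1)"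
        using Suc \<mm>_eq_monomial_span by (intro monomial_span_mult) auto
      with step(3) show ?case by (simp add: span_add)
    qed (rule span_zero)
  qed
qed

end

end

section \<open>The truncated exponential, its monomial expansion and the action of differential
  operators\<close>

locale comm_algebra_char_0 = comm_algebra scale
  for scale :: "'f::field_char_0 \<Rightarrow> 'a::comm_ring_1 \<Rightarrow> 'a"
begin

lemma of_nat_mult_conv_scale: "of_nat n * x = scale (of_nat n) x"
  by (induction n) (simp_all add: distrib_right scale_left_distrib)

abbreviation divided_power :: "nat \<Rightarrow> 'a \<Rightarrow> 'a" where
  "divided_power r x \<equiv> scale (1 / fact r) (x ^ r)"

text \<open>Dividing by factorials absorbs the binomial coefficients of the binomial
  theorem.\<close>

lemma divided_power_add:
  "divided_power r (x + y) = (\<Sum>k\<le>r. divided_power k x * divided_power (r - k) y)"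
proof -
  have "divided_power r (x + y) =
      (\<Sum>k\<le>r. scale (1 / fact r) (of_nat (r choose k) * x ^ k * y ^ (r - k)))"
    by (simp add: binomial_ring scale_sum_right)
  also have "\<dots> = (\<Sum>k\<le>r. divided_power k x * divided_power (r - k) y)"
  proof (rule sum.cong[OF refl])
    fix k assume "k \<in> {..r}"
    then have "(1 / fact r) * of_nat (r choose k) = (1 / fact k) * (1 / fact (r - k) :: 'f)"
      by (simp add: binomial_fact)
    then show "scale (1 / fact r) (of_nat (r choose k) * x ^ k * y ^ (r - k)) =
        divided_power k x * divided_power (r - k) y"
      by (simp add: mult.assoc of_nat_mult_conv_scale scale_mult_left scale_mult_right)
  qed
  finally show ?thesis .
qed

text \<open>The expansion of the left side runs over the triangle
  \<open>j + k \<le> nil_index J\<close>, the product over the full square; the assumption kills the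
  difference.\<close>

lemma nil_exp_add:
  assumes "\<And>j k. j + k > nil_index J \<Longrightarrow> x ^ j * y ^ k = 0"
  shows "nil_exp scale J (x + y) = nil_exp scale J x * nil_exp scale J y"
proof -
  let ?N = "nil_index J"
  have "nil_exp scale J (x + y) =
      (\<Sum>(j, k)\<in>{(j, k). j + k \<le> ?N}. divided_power j x * divided_power k y)"
    unfolding nil_exp_def divided_power_add sum.triangle_reindex_eq ..
  also have "\<dots> = (\<Sum>(j, k)\<in>{..?N} \<times> {..?N}. divided_power j x * divided_power k y)"
    using assms
    by (intro sum.mono_neutral_left) (auto simp: scale_mult_left scale_mult_right simp flip: not_less)
  also have "\<dots> = nil_exp scale J x * nil_exp scale J y"
    by (simp add: nil_exp_def sum_product sum.cartesian_product)
  finally show ?thesis .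
qed

lemma nil_exp_sum:
  assumes J: "is_ideal J" and nil: "\<And>r. r > nil_index J \<Longrightarrow> ideal_power J r = {0}"
    and "finite S" "\<And>i. i \<in> S \<Longrightarrow> x i \<in> J"
  shows "nil_exp scale J (\<Sum>i\<in>S. x i) = (\<Prod>i\<in>S. nil_exp scale J (x i))"
proof -
  \<comment> \<open>Membership of the partial sum in \<open>J\<close> is carried along because the
    vanishing of mixed products of high degree depends on it.\<close>
  have "(\<Sum>i\<in>S. x i) \<in> J \<and> nil_exp scale J (\<Sum>i\<in>S. x i) = (\<Prod>i\<in>S. nil_exp scale J (x i))"
    using assms(3,4)
  proof (induction S rule: finite_induct)
    case empty
    have "nil_exp scale J 0 = (\<Sum>r\<le>nil_index J. if r = 0 then 1 else 0)"
      unfolding nil_exp_def by (rule sum.cong) (auto simp: power_0_left)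
    then show ?case using is_idealD(1)[OF J] by simp
  next
    case (insert i S)
    have "x i ^ j * (\<Sum>i\<in>S. x i) ^ k = 0" if "j + k > nil_index J" for j k
    proof -
      have "1 * x i ^ j \<in> ideal_power J (0 + j)"
        using insert.prems by (intro power_in_ideal_power[OF J]) auto
      then have "x i ^ j * (\<Sum>i\<in>S. x i) ^ k \<in> ideal_power J (j + k)"
        using insert by (intro power_in_ideal_power[OF J]) auto
      with nil[OF that] show ?thesis by simp
    qed
    then have "nil_exp scale J (x i + (\<Sum>i\<in>S. x i)) = nil_exp scale J (x i) * nil_exp scale J (\<Sum>i\<in>S. x i)"
      by (rule nil_exp_add)
    with insert is_idealD(2)[OF J] show ?case by simp
  qed
  then show ?thesis ..
qed

text \<open>Each \<open>\<partial>/\<partial>y\<^sub>i\<close> and hence every \<open>f(\<partial>)\<close> acts on polynomials of the form \<open>\<omega>(a exp(\<Sum> y\<^sub>i e\<^sub>i))\<close>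
  by multiplying \<open>a\<close> with \<open>e\<^sub>i\<close> and \<open>f(e)\<close>, respectively.\<close>

definition exp_generating :: "('a \<Rightarrow> 'f) \<Rightarrow> ('n::finite \<Rightarrow> 'a) \<Rightarrow> 'a \<Rightarrow> ('n, 'f) mpoly \<Rightarrow> bool" where
  "exp_generating \<omega> e a g \<longleftrightarrow>
     (\<forall>m. Poly_Mapping.lookup g m = \<omega> (a * monomial_value e m) / monomial_fact m)"

lemma exp_generating_pderiv:
  assumes "exp_generating \<omega> e a g"
  shows "exp_generating \<omega> e (e i * a) (mpoly_pderiv i g)"
  unfolding exp_generating_def
proof
  fix m
  \<comment> \<open>The factor produced by differentiation cancels the one gained by
    \<open>monomial_fact\<close>; this needs it to be nonzero, as it is in characteristic
    zero.\<close>
  have "(of_nat (Suc (Poly_Mapping.lookup m i)) :: 'f) \<noteq> 0" by (simp only: of_nat_eq_0_iff)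
  moreover have "Poly_Mapping.lookup g (m + Poly_Mapping.single i 1) =
      \<omega> (e i * a * monomial_value e m) / (of_nat (Suc (Poly_Mapping.lookup m i)) * monomial_fact m)"
    using assms
    by (simp only: exp_generating_def monomial_fact_add_single monomial_value_add
        monomial_value_single power_one_right mult_ac)
  ultimately show "Poly_Mapping.lookup (mpoly_pderiv i g) m =
      \<omega> (e i * a * monomial_value e m) / monomial_fact m"
    unfolding lookup_mpoly_pderiv by (simp del: of_nat_Suc)
qed

lemma exp_generating_pderiv_funpow:
  assumes "exp_generating \<omega> e a g"
  shows "exp_generating \<omega> e (e i ^ r * a) ((mpoly_pderiv i ^^ r) g)"
proof (induction r)
  case (Suc r)
  from exp_generating_pderiv[OF this, of i] show ?case by (simp add: mult.assoc)
qed (simp add: assms)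

lemma exp_generating_monomial_diff:
  assumes "exp_generating \<omega> e a g"
  shows "exp_generating \<omega> e (monomial_value e m * a) (monomial_diff m g)"
proof -
  interpret comp_fun_commute "\<lambda>i. mpoly_pderiv i ^^ Poly_Mapping.lookup m i"
    by (rule comp_fun_commute_mpoly_pderiv)
  have "exp_generating \<omega> e ((\<Prod>i\<in>S. e i ^ Poly_Mapping.lookup m i) * a)
      (Finite_Set.fold (\<lambda>i. mpoly_pderiv i ^^ Poly_Mapping.lookup m i) g S)" if "finite S" for S
    using that
  proof (induction S rule: finite_induct)
    case (insert i S)
    from exp_generating_pderiv_funpow[OF insert.IH] insert.hyps show ?case
      by (simp add: mult.assoc)
  qed (simp add: assms)
  then show ?thesis by (simp add: monomial_diff_def monomial_value_def)
qed

lemma exp_generating_mpoly_diff: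
  assumes "Vector_Spaces.linear scale (*) \<omega>" "exp_generating \<omega> e a g"
  shows "exp_generating \<omega> e (mpoly_eval scale e f * a) (mpoly_diff f g)"
  unfolding exp_generating_def
proof
  fix n
  interpret \<omega>: Vector_Spaces.linear scale "(*)" \<omega> by (rule assms(1))
  have "Poly_Mapping.lookup (mpoly_diff f g) n =
      (\<Sum>m\<in>Poly_Mapping.keys f. Poly_Mapping.lookup f m *
        (\<omega> (monomial_value e m * a * monomial_value e n) / monomial_fact n))"
    using exp_generating_monomial_diff[OF assms(2)]
    by (simp add: mpoly_diff_def lookup_sum lookup_single_0_mult exp_generating_def)
  also have "\<dots> = \<omega> (mpoly_eval scale e f * a * monomial_value e n) / monomial_fact n"
    by (simp add: mpoly_eval_conv_monomial_value sum_distrib_right \<omega>.sum \<omega>.scale scale_mult_left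
        sum_divide_distrib)
  finally show "Poly_Mapping.lookup (mpoly_diff f g) n =
      \<omega> (mpoly_eval scale e f * a * monomial_value e n) / monomial_fact n" .
qed

lemma linear_nil_exp_conv_monomials:
  fixes e :: "'n::finite \<Rightarrow> 'a"
  assumes "Vector_Spaces.linear scale (*) \<omega>" "is_ideal J"
    and nil: "\<And>r. r > nil_index J \<Longrightarrow> ideal_power J r = {0}" and e: "\<And>i. e i \<in> J"
  shows "\<exists>M. finite M \<and> (\<forall>m. m \<notin> M \<longrightarrow> monomial_value e m = 0) \<and>
    (\<forall>y. \<omega> (nil_exp scale J (\<Sum>i\<in>UNIV. scale (y i) (e i))) =
      (\<Sum>m\<in>M. \<omega> (monomial_value e m) / monomial_fact m * monomial_value y m))"
proof -
  interpret \<omega>: Vector_Spaces.linear scale "(*)" \<omega> by (rule assms(1))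
  let ?N = "nil_index J"
  \<comment> \<open>A box of exponents, not a bound on the total degree: distributing the product of
    the \<open>k\<close> truncated exponentials gives one term for each choice of an exponent in
    every factor.\<close>
  define M where "M = {m :: 'n \<Rightarrow>\<^sub>0 nat. \<forall>i. Poly_Mapping.lookup m i \<le> ?N}"
  have bij: "bij_betw Poly_Mapping.lookup M (PiE UNIV (\<lambda>_. {..?N}))"
  proof (rule bij_betwI[where g = Abs_poly_mapping])
    have *: "Poly_Mapping.lookup (Abs_poly_mapping g) = g" for g :: "'n \<Rightarrow> nat"
      by (rule Abs_poly_mapping_inverse) simp
    show "Poly_Mapping.lookup \<in> M \<rightarrow> PiE UNIV (\<lambda>_. {..?N})" by (auto simp: M_def)
    show "Abs_poly_mapping \<in> PiE UNIV (\<lambda>_. {..?N}) \<rightarrow> M" by (auto simp: M_def *)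
    show "Poly_Mapping.lookup (Abs_poly_mapping g) = g" for g :: "'n \<Rightarrow> nat" by (rule *)
  qed (simp add: lookup_inverse)
  have fin: "finite M"
    using bij_betw_finite[OF bij] by (simp add: finite_PiE)
  have power_zero: "e i ^ r = 0" if "r > ?N" for i r
    using power_in_ideal_power[OF assms(2) e, of 1 0 i r] nil[OF that] by simp
  have zero: "monomial_value e m = 0" if "m \<notin> M" for m
  proof -
    from that obtain i where "Poly_Mapping.lookup m i > ?N" by (auto simp: M_def not_le)
    then show ?thesis
      unfolding monomial_value_def using power_zero by (intro prod_zero bexI[of _ i]) auto
  qed
  have "\<omega> (nil_exp scale J (\<Sum>i\<in>UNIV. scale (y i) (e i))) =
      (\<Sum>m\<in>M. \<omega> (monomial_value e m) / monomial_fact m * monomial_value y m)" for y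
  proof -
    have "nil_exp scale J (\<Sum>i\<in>UNIV. scale (y i) (e i)) =
        (\<Prod>i\<in>UNIV. \<Sum>r\<le>?N. divided_power r (scale (y i) (e i)))"
      unfolding nil_exp_def[symmetric]
      by (intro nil_exp_sum assms(2) nil subspace_scale[OF is_ideal_subspace[OF assms(2)]] e) simp_all
    also have "\<dots> = (\<Sum>g\<in>PiE UNIV (\<lambda>_. {..?N}). \<Prod>i\<in>UNIV. divided_power (g i) (scale (y i) (e i)))"
      by (rule prod_sum_PiE) auto
    also have "\<dots> = (\<Sum>m\<in>M. \<Prod>i\<in>UNIV.
        divided_power (Poly_Mapping.lookup m i) (scale (y i) (e i)))"
      by (rule sum.reindex_bij_betw[OF bij, symmetric])
    also have "\<dots> = (\<Sum>m\<in>M. scale (monomial_value y m / monomial_fact m) (monomial_value e m))"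
      by (simp add: scale_power prod_scale monomial_value_def monomial_fact_def prod_dividef)
    finally show ?thesis by (simp add: \<omega>.sum \<omega>.scale mult.commute)
  qed
  with fin zero show ?thesis by blast
qed

text \<open>\<open>Q\<close> is given only through its values, so its coefficients are recovered
  from the independence of monomial functions.\<close>

lemma exp_generating_if_eval_eq_nil_exp:
  fixes e :: "'n::finite \<Rightarrow> 'a"
  assumes "Vector_Spaces.linear scale (*) \<omega>" "is_ideal J"
    and "\<And>r. r > nil_index J \<Longrightarrow> ideal_power J r = {0}" "\<And>i. e i \<in> J"
    and Q: "\<And>y. mpoly_eval (*) y Q = \<omega> (nil_exp scale J (\<Sum>i\<in>UNIV. scale (y i) (e i)))"
  shows "exp_generating \<omega> e 1 Q"
proof -
  interpret \<omega>: Vector_Spaces.linear scale "(*)" \<omega> by (rule assms(1))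
  let ?c = "\<lambda>m. \<omega> (monomial_value e m) / monomial_fact m"
  from linear_nil_exp_conv_monomials[where \<omega> = \<omega> and J = J and e = e, OF assms(1-4)]
  obtain M where M: "finite M" "\<And>m. m \<notin> M \<Longrightarrow> monomial_value e m = 0"
    "\<And>y. \<omega> (nil_exp scale J (\<Sum>i\<in>UNIV. scale (y i) (e i))) = (\<Sum>m\<in>M. ?c m * monomial_value y m)"
    by blast
  \<comment> \<open>Over this common finite index set both expansions can be subtracted; each
    contributes zeros outside its own part.\<close>
  let ?K = "M \<union> Poly_Mapping.keys Q"
  have "(\<Sum>m\<in>?K. (Poly_Mapping.lookup Q m - ?c m) * monomial_value y m) = 0" for y
  proof -
    have "(\<Sum>m\<in>?K. Poly_Mapping.lookup Q m * monomial_value y m) = mpoly_eval (*) y Q"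
      unfolding mpoly_eval_conv_monomial_value using M(1)
      by (intro sum.mono_neutral_right) (auto simp: in_keys_iff)
    moreover have "(\<Sum>m\<in>?K. ?c m * monomial_value y m) = (\<Sum>m\<in>M. ?c m * monomial_value y m)"
      using M(1,2) by (intro sum.mono_neutral_right) (auto simp: \<omega>.zero)
    ultimately show ?thesis
      using Q M(3) by (simp add: left_diff_distrib sum_subtractf)
  qed
  then have on_K: "Poly_Mapping.lookup Q m - ?c m = 0" if "m \<in> ?K" for m
    using monomial_functions_independent[where M = ?K and c = "\<lambda>m. Poly_Mapping.lookup Q m - ?c m"]
      that M(1) by simp
  have "Poly_Mapping.lookup Q m = ?c m" for m
  proof (cases "m \<in> ?K")
    case False
    then show ?thesis using M(2) by (auto simp: in_keys_iff \<omega>.zero)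
  qed (use on_K in auto)
  then show ?thesis by (simp add: exp_generating_def)
qed

end

text \<open>The binder of \<open>HOL-Library.FuncSet\<close> would capture the variable \<open>\<Pi>\<close>.\<close>

no_syntax
  "_Pi" :: "pttrn \<Rightarrow> 'a set \<Rightarrow> 'b set \<Rightarrow> ('a \<Rightarrow> 'b) set"
    (\<open>(\<open>indent=3 notation=\<open>binder \<Pi>\<in>\<close>\<close>\<Pi> _\<in>_./ _)\<close> 10)

section \<open>Annihilator and degree of the restricted nil-polynomial\<close>

theorem theorem5p1:
  fixes scale :: "'f::field_char_0 \<Rightarrow> 'a::comm_ring_1 \<Rightarrow> 'a"
    and \<mm> \<Pi> L :: "'a set"
    and \<omega> :: "'a \<Rightarrow> 'f"
    and P :: "'a \<Rightarrow> 'f"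
    and e :: "'n::finite \<Rightarrow> 'a"
    and Q :: "('n, 'f) mpoly"
    and I :: "('n, 'f) mpoly set"
  assumes gorenstein: "gorenstein_algebra scale \<mm>"
    and dim_A: "vector_space.dim scale (UNIV :: 'a set) > 2"
    and embedding_dim: "quotient_dim scale \<mm> (ideal_power \<mm> 2) = CARD('n)"
    and hyperplane: "hyperplane_in scale \<mm> \<Pi>"
    and compl_Ann: "complementary_in scale \<mm> \<Pi> (Ann_ideal \<mm>)"
    and linear_form: "Vector_Spaces.linear scale (*) \<omega>"
    and ker_\<omega>: "{a. \<omega> a = 0} = module.span scale (insert 1 \<Pi>)"
    and nil_polynomial: "\<And>u. u \<in> \<Pi> \<Longrightarrow> P u = \<omega> (nil_exp scale \<mm> u)"
    and L_in_\<Pi>: "L \<subseteq> \<Pi>"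
    and dim_L: "vector_space.dim scale L = CARD('n)"
    and compl_square: "complementary_in scale \<mm> L (ideal_power \<mm> 2)"
    and basis_inj: "inj e"
    and basis_independent: "\<not> module.dependent scale (range e)"
    and basis_span: "module.span scale (range e) = L"
    and Q_restriction: "\<And>y. mpoly_eval (*) y Q = P (\<Sum>i\<in>UNIV. scale (y i) (e i))"
    and I_def: "I = {f. mpoly_eval scale e f = 0}"
  shows "inverse_system (nil_index \<mm>) I Q"
proof -
  interpret gorenstein_algebra scale \<mm> by (rule gorenstein)
  interpret comm_algebra_char_0 scale by unfold_locales
  interpret \<omega>: Vector_Spaces.linear scale "(*)" \<omega> by (rule linear_form)
  let ?\<nu> = "nil_index \<mm>"
  have \<Pi>: "subspace \<Pi>" "\<Pi> \<inter> Ann_ideal \<mm> = {0}" "\<Pi> \<subseteq> \<mm>"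
    using compl_Ann hyperplane by (auto simp: complementary_in_def hyperplane_in_def)
  have e_L: "e i \<in> L" for i using span_base[of "e i" "range e"] basis_span by auto
  have e_\<mm>: "range e \<subseteq> \<mm>" using e_L L_in_\<Pi> \<Pi>(3) by blast
  have gen: "\<exists>u\<in>span (range e). x - u \<in> ideal_power \<mm> 2" if "x \<in> \<mm>" for x
  proof -
    from that compl_square obtain u w where "u \<in> L" "w \<in> ideal_power \<mm> 2" "x = u + w"
      unfolding complementary_in_def by blast
    then show ?thesis using basis_span by (intro bexI[of _ u]) auto
  qed
  note spans = monomial_span_0[of e, OF gen e_\<mm>] ideal_power_subset_monomial_span[of e, OF gen e_\<mm>]

  \<comment> \<open>An element of the kernel is a scalar plus an element of \<open>\<Pi>\<close>. If
    it lies in \<open>\<mm>\<close>, the scalar must vanish as \<open>1\<close> is not in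
    \<open>\<mm>\<close>, which leaves an element of the trivial intersection of
    \<open>\<Pi>\<close> and \<open>Ann_ideal \<mm>\<close>.\<close>
  have \<omega>_Ann: "u = 0" if u: "u \<in> Ann_ideal \<mm>" "\<omega> u = 0" for u
  proof -
    have "u \<in> span (insert 1 \<Pi>)" using u(2) ker_\<omega> by blast
    moreover have "span \<Pi> = \<Pi>" using \<Pi>(1) by (simp add: span_eq_iff)
    ultimately obtain c where c: "u - scale c 1 \<in> \<Pi>"
      using span_breakdown_eq[of u 1 \<Pi>] by auto
    have "scale c 1 \<in> \<mm>"
      using is_idealD(5)[OF ideal_\<mm>, of u "u - scale c 1"] u(1) c \<Pi>(3) by (auto simp: Ann_ideal_def)
    then have "scale (inverse c) (scale c 1) \<in> \<mm>"
      by (rule subspace_scale[OF is_ideal_subspace[OF ideal_\<mm>]])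
    then have "c = 0" using one_notin_\<mm> by (cases "c = 0") auto
    with c u(1) \<Pi>(2) show ?thesis by auto
  qed

  have "mpoly_eval (*) y Q = \<omega> (nil_exp scale \<mm> (\<Sum>i\<in>UNIV. scale (y i) (e i)))" for y
    unfolding Q_restriction
    by (intro nil_polynomial subspace_sum \<Pi>(1) subspace_scale) (use e_L L_in_\<Pi> in blast)
  then have Q: "exp_generating \<omega> e 1 Q"
    using e_\<mm> by (intro exp_generating_if_eval_eq_nil_exp[where J = \<mm>] linear_form ideal_\<mm>
        ideal_power_gt_nil_index) auto

  have "mpoly_eval scale e f = 0 \<longleftrightarrow> mpoly_diff f Q = 0" for f
  proof -
    let ?a = "mpoly_eval scale e f"
    have coeff: "Poly_Mapping.lookup (mpoly_diff f Q) m = \<omega> (?a * monomial_value e m) / monomial_fact m" for m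
      using exp_generating_mpoly_diff[OF linear_form Q, of f] by (simp add: exp_generating_def)
    show ?thesis
    proof
      assume "?a = 0"
      then show "mpoly_diff f Q = 0" by (intro poly_mapping_eqI) (simp add: coeff \<omega>.zero)
    next
      assume "mpoly_diff f Q = 0"
      then have "\<omega> (?a * monomial_value e m) = 0" for m using coeff[of m] by simp
      moreover have "subspace {x. \<omega> (?a * x) = 0}"
        by (rule subspaceI) (simp_all add: \<omega>.zero distrib_left \<omega>.add scale_mult_right \<omega>.scale)
      \<comment> \<open>The vanishing extends from monomials to all of the algebra, that is,
        \<open>\<omega>\<close> is zero on the ideal generated by \<open>?a\<close>.\<close>
      ultimately have "monomial_span e 0 \<subseteq> {x. \<omega> (?a * x) = 0}"
        by (intro span_minimal) auto
      then have "\<omega> (?a * x) = 0" for x using spans(1) by auto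
      then show "?a = 0" using obtain_multiple_in_Ann[of ?a] \<omega>_Ann by metis
    qed
  qed
  then have "I = Ann_poly Q" by (auto simp: I_def Ann_poly_def)

  have zero_above: "monomial_value e m = 0" if "monomial_degree m > ?\<nu>" for m
    using monomial_value_in_power[of e, OF gen e_\<mm>, of m] ideal_power_gt_nil_index[OF that] by simp
  have coeff: "Poly_Mapping.lookup Q m = \<omega> (monomial_value e m) / monomial_fact m" for m
    using Q by (simp add: exp_generating_def)
  \<comment> \<open>Otherwise \<open>\<omega>\<close> would vanish on the last nonzero power of
    \<open>\<mm>\<close>, which lies in \<open>Ann_ideal \<mm>\<close>, where
    \<open>\<omega>\<close> is injective.\<close>
  have "\<exists>m. monomial_degree m = ?\<nu> \<and> \<omega> (monomial_value e m) \<noteq> 0"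
  proof (rule ccontr)
    assume no: "\<nexists>m. monomial_degree m = ?\<nu> \<and> \<omega> (monomial_value e m) \<noteq> 0"
    have "\<omega> (monomial_value e m) = 0" if "?\<nu> \<le> monomial_degree m" for m
      using no zero_above[of m] that by (cases "monomial_degree m = ?\<nu>") (auto simp: \<omega>.zero)
    moreover have "subspace {x. \<omega> x = 0}"
      by (rule subspaceI) (simp_all add: \<omega>.zero \<omega>.add \<omega>.scale)
    ultimately have "monomial_span e ?\<nu> \<subseteq> {x. \<omega> x = 0}" by (intro span_minimal) auto
    then have \<omega>_zero: "\<omega> x = 0" if "x \<in> ideal_power \<mm> ?\<nu>" for x using spans(2) that by blast
    obtain z where z: "z \<in> ideal_power \<mm> ?\<nu>" "z \<noteq> 0"
      using ideal_power_nil_index is_idealD(1)[OF is_ideal_ideal_power, of \<mm> ?\<nu>] by blast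
    have "z * v = 0" if "v \<in> \<mm>" for v
      using ideal_power_mult[OF z(1) that] ideal_power_gt_nil_index[of "Suc ?\<nu>"] by (simp del: ideal_power.simps)
    \<comment> \<open>Positivity of the nil-index makes \<open>?\<nu> - 1\<close> a genuine
      predecessor, so that \<open>ideal_power_subset\<close> applies.\<close>
    moreover have "z \<in> \<mm>"
      using z(1) ideal_power_subset[OF ideal_\<mm>, of "?\<nu> - 1"] nil_index_pos by auto
    ultimately have "z \<in> Ann_ideal \<mm>" by (simp add: Ann_ideal_def)
    with \<omega>_Ann \<omega>_zero z show False by blast
  qed
  then obtain m where m: "monomial_degree m = ?\<nu>" "m \<in> Poly_Mapping.keys Q"
    by (auto simp: in_keys_iff coeff)
  have "monomial_degree n \<le> ?\<nu>" if "n \<in> Poly_Mapping.keys Q" for n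
    using that zero_above[of n] by (auto simp: in_keys_iff coeff \<omega>.zero not_less[symmetric])
  with m have "mpoly_degree Q = ?\<nu>"
    unfolding mpoly_degree_conv_monomial_degree by (intro Max_eqI) (auto intro: rev_image_eqI)
  with \<open>I = Ann_poly Q\<close> show ?thesis by (simp add: inverse_system_def)
qed

end
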